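(* Fix the rotational component $\mathbf B(\mathbf x)\boldsymbol\omega$ and let $\mathbf r(\mathbf x):=\mathbf u(\mathbf x)-\mathbf B(\mathbf x)\boldsymbol\omega$ be the observed translational residual. Then for every camera baseline $\mathbf T\in\mathbb{R}^3$ and every positive depth field $Z(\cdot)$, the object field $$\mathbf V_o(\mathbf x):=Z(\mathbf x)\,\mathbf r(\mathbf x)-\mathbf M(\mathbf x)\mathbf T$$ reproduces $\mathbf r$ exactly, i.e. $\tfrac{1}{Z(\mathbf x)}\big(\mathbf M(\mathbf x)\mathbf T+\mathbf V_o(\mathbf x)\big)=\mathbf r(\mathbf x)$. Consequently $\mathbf T$ is unconstrained by $\mathbf r$ alone, the decomposition (of the residual into camera-translational and object parts) lies in a $\ge 3$-parameter gauge, and any 2D-conditioned model must resolve it by prior, incurring cross-talk wherever the prior is wrong.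
   Context: Image points are $\mathbf x=(x,y)$ and $f$ is the focal length. For a scene point at depth $Z$, under camera linear velocity (baseline) $\mathbf T=(T_x,T_y,T_z)\in\mathbb{R}^3$, camera angular velocity $\boldsymbol\omega\in\mathbb{R}^3$ and object self-velocity $(V_x,V_y,V_z)$, the instantaneous image motion is $\mathbf u=\mathbf u_T+\mathbf u_R+\mathbf u_O$ with camera-translational part $\mathbf u_T=\tfrac1Z\mathbf M(\mathbf x)\mathbf T$, rotational part $\mathbf u_R=\mathbf B(\mathbf x)\boldsymbol\omega$ and object part $\mathbf u_O=\tfrac1Z\mathbf V_o(\mathbf x)$, where $$\mathbf M(\mathbf x)=\begin{bmatrix}-f&0&x\\0&-f&y\end{bmatrix},\qquad \mathbf B(\mathbf x)=\begin{bmatrix}xy/f&-(f+x^2/f)&y\\ f+y^2/f&-xy/f&-x\end{bmatrix},$$ and the object field $\mathbf V_o(\mathbf x)=[\,fV_x-xV_z,\ fV_y-yV_z\,]^{\top}$ collects the object's self-velocity. The setting is controllable video generation, in which the camera motion and the subject (object) motion are to be commanded independently. A 2D-conditioned model is a controller whose conditioning is the 2D image motion field alone, and cross-talk means interference (leakage) between the camera control and the subject control. These last two notions, and "gauge" (the freedom in choosing among mutually consistent camera/object/depth explanations of the same $\mathbf r$), are used informally. *)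

theory Defs
  imports "HOL-Analysis.Analysis"
begin

type_synonym point = "real^2"
type_synonym field = "point \<Rightarrow> real^2"

definition M_mat :: "real \<Rightarrow> point \<Rightarrow> real^3^2" where
  "M_mat f p = vector [vector [- f, 0, p$1], vector [0, - f, p$2]]"

definition B_mat :: "real \<Rightarrow> point \<Rightarrow> real^3^2" where
  "B_mat f p = vector
     [vector [p$1 * p$2 / f, - (f + (p$1)\<^sup>2 / f), p$2],
      vector [f + (p$2)\<^sup>2 / f, - (p$1 * p$2 / f), - (p$1)]]"

definition object_velocity_field :: "real \<Rightarrow> (point \<Rightarrow> real^3) \<Rightarrow> field" where
  "object_velocity_field f V p =
     vector [f * V p $ 1 - p$1 * V p $ 3, f * V p $ 2 - p$2 * V p $ 3]"

definition camera_part :: "real \<Rightarrow> real^3 \<Rightarrow> (point \<Rightarrow> real) \<Rightarrow> field" where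
  "camera_part f T Z p = (1 / Z p) *\<^sub>R (M_mat f p *v T)"

definition object_part :: "(point \<Rightarrow> real) \<Rightarrow> field \<Rightarrow> field" where
  "object_part Z W p = (1 / Z p) *\<^sub>R W p"

definition positive_on :: "point set \<Rightarrow> (point \<Rightarrow> real) \<Rightarrow> bool" where
  "positive_on \<Omega> Z \<longleftrightarrow> (\<forall>p\<in>\<Omega>. 0 < Z p)"

(* The camera angular velocity is held fixed throughout, so it is a separate
   parameter rather than a component of the scene. *)
record scene =
  baseline :: "real^3"
  depth :: "point \<Rightarrow> real"
  self_velocity :: "point \<Rightarrow> real^3"

definition valid_scene :: "point set \<Rightarrow> scene \<Rightarrow> bool" where
  "valid_scene \<Omega> s \<longleftrightarrow> positive_on \<Omega> (depth s)"

definition scene_object_field :: "real \<Rightarrow> scene \<Rightarrow> field" where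
  "scene_object_field f s = object_velocity_field f (self_velocity s)"

definition image_motion :: "real \<Rightarrow> real^3 \<Rightarrow> scene \<Rightarrow> field" where
  "image_motion f \<omega> s p =
     camera_part f (baseline s) (depth s) p + B_mat f p *v \<omega>
     + object_part (depth s) (scene_object_field f s) p"

definition same_motion :: "real \<Rightarrow> real^3 \<Rightarrow> point set \<Rightarrow> scene \<Rightarrow> scene \<Rightarrow> bool" where
  "same_motion f \<omega> \<Omega> s s' \<longleftrightarrow> (\<forall>p\<in>\<Omega>. image_motion f \<omega> s p = image_motion f \<omega> s' p)"

definition residual :: "real \<Rightarrow> real^3 \<Rightarrow> field \<Rightarrow> field" where
  "residual f \<omega> u p = u p - B_mat f p *v \<omega>"

definition gauge_object_field ::
    "real \<Rightarrow> field \<Rightarrow> real^3 \<Rightarrow> (point \<Rightarrow> real) \<Rightarrow> field" where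
  "gauge_object_field f r T Z p = Z p *\<^sub>R r p - M_mat f p *v T"

(* camera baseline, depth field, object field *)
type_synonym explanation = "(real^3) \<times> (point \<Rightarrow> real) \<times> field"

definition explanations :: "real \<Rightarrow> point set \<Rightarrow> field \<Rightarrow> explanation set" where
  "explanations f \<Omega> r = {(T, Z, W). positive_on \<Omega> Z \<and>
     (\<forall>p\<in>\<Omega>. (1 / Z p) *\<^sub>R (M_mat f p *v T + W p) = r p)}"

(* A family of fields on a domain, depending affinely on k real parameters, in which
   distinct parameter values give distinct fields.  Affinity excludes the set-theoretic
   injections that would make the number of parameters meaningless. *)
definition affine_parameters ::
    "point set \<Rightarrow> (real^'k::finite \<Rightarrow> point \<Rightarrow> 'v::real_vector) \<Rightarrow> bool" where
  "affine_parameters \<Omega> g \<longleftrightarrow>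
     (\<forall>p\<in>\<Omega>. linear (\<lambda>t. g t p - g 0 p)) \<and>
     (\<forall>s t. s \<noteq> t \<longrightarrow> (\<exists>p\<in>\<Omega>. g s p \<noteq> g t p))"

(* A controller is commanded by a scene (camera motion, depth, subject motion) and
   realises some camera/depth/object explanation. *)
type_synonym controller = "scene \<Rightarrow> explanation"

definition conditioned_2D :: "real \<Rightarrow> real^3 \<Rightarrow> point set \<Rightarrow> controller \<Rightarrow> bool" where
  "conditioned_2D f \<omega> \<Omega> C \<longleftrightarrow>
     (\<forall>s s'. valid_scene \<Omega> s \<and> valid_scene \<Omega> s' \<and> same_motion f \<omega> \<Omega> s s' \<longrightarrow> C s = C s')"

definition resolves :: "real \<Rightarrow> real^3 \<Rightarrow> point set \<Rightarrow> controller \<Rightarrow> bool" where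
  "resolves f \<omega> \<Omega> C \<longleftrightarrow>
     (\<forall>s. valid_scene \<Omega> s \<longrightarrow>
        C s \<in> explanations f \<Omega> (residual f \<omega> (image_motion f \<omega> s)))"

(* A prior picks a baseline and a depth field from the residual on the image domain;
   restrict discards everything outside that domain. *)
type_synonym prior = "field \<Rightarrow> (real^3) \<times> (point \<Rightarrow> real)"

definition prior_choice ::
    "real \<Rightarrow> real^3 \<Rightarrow> point set \<Rightarrow> prior \<Rightarrow> scene \<Rightarrow> (real^3) \<times> (point \<Rightarrow> real)" where
  "prior_choice f \<omega> \<Omega> \<pi> s = \<pi> (restrict (residual f \<omega> (image_motion f \<omega> s)) \<Omega>)"

definition resolved_by_prior ::
    "real \<Rightarrow> real^3 \<Rightarrow> point set \<Rightarrow> controller \<Rightarrow> prior \<Rightarrow> bool" where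
  "resolved_by_prior f \<omega> \<Omega> C \<pi> \<longleftrightarrow>
     (\<forall>s T Z W. valid_scene \<Omega> s \<and> C s = (T, Z, W) \<longrightarrow>
        (T, Z) = prior_choice f \<omega> \<Omega> \<pi> s \<and>
        (\<forall>p\<in>\<Omega>. W p =
           gauge_object_field f (residual f \<omega> (image_motion f \<omega> s)) T Z p))"

definition prior_wrong_at ::
    "real \<Rightarrow> real^3 \<Rightarrow> point set \<Rightarrow> prior \<Rightarrow> scene \<Rightarrow> point \<Rightarrow> bool" where
  "prior_wrong_at f \<omega> \<Omega> \<pi> s p \<longleftrightarrow>
     (let (T, Z) = prior_choice f \<omega> \<Omega> \<pi> s
      in camera_part f T Z p \<noteq> camera_part f (baseline s) (depth s) p)"

(* Leakage: a nonzero amount d of image motion is moved from the commanded camera part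
   into the realised object part (with the opposite sign: from object to camera). *)
definition cross_talk_at :: "real \<Rightarrow> controller \<Rightarrow> scene \<Rightarrow> point \<Rightarrow> bool" where
  "cross_talk_at f C s p \<longleftrightarrow>
     (let (T, Z, W) = C s
      in \<exists>d. d \<noteq> 0 \<and>
           camera_part f T Z p = camera_part f (baseline s) (depth s) p - d \<and>
           object_part Z W p = object_part (depth s) (scene_object_field f s) p + d)"

end

theory Submission
  imports Defs
begin

text \<open>
  Because \<open>Z > 0\<close> and \<open>f \<noteq> 0\<close>, every planar field is the object field of some self-velocity
  (one may take \<open>V\<^sub>z = 0\<close>), so the object part absorbs whatever the camera part leaves of the residual.
  The camera part determines the baseline up to the kernel of \<open>M(x)\<close>, the line spanned by
  \<open>(x, y, f)\<close>; these lines meet only in \<open>0\<close> for distinct image points, so two points already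
  separate all three baseline parameters and a wrong baseline can go unnoticed at one point at most.
\<close>

section \<open>Camera matrix and object velocity fields\<close>

lemma M_mat_mult: "M_mat f p *v T = vector [p$1 * T$3 - f * T$1, p$2 * T$3 - f * T$2]"
  by (simp add: M_mat_def vec_eq_iff forall_2 matrix_vector_mult_def sum_3)

lemma M_mat_mult_eq_at_two_points:
  assumes "f \<noteq> 0" "p \<noteq> q"
    and "M_mat f p *v S = M_mat f p *v T" "M_mat f q *v S = M_mat f q *v T"
  shows "S = T"
proof -
  define d where "d = S - T"
  have d: "M_mat f p *v d = 0" "M_mat f q *v d = 0"
    using assms(3,4) by (simp_all add: d_def matrix_vector_mult_diff_distrib)
  then have e: "p$1 * d$3 = f * d$1" "p$2 * d$3 = f * d$2" "q$1 * d$3 = f * d$1" "q$2 * d$3 = f * d$2"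
    by (simp_all add: M_mat_mult vec_eq_iff forall_2)
  moreover have "p$1 \<noteq> q$1 \<or> p$2 \<noteq> q$2"
    using \<open>p \<noteq> q\<close> by (simp add: vec_eq_iff forall_2)
  \<comment> \<open>In a coordinate where \<open>p\<close> and \<open>q\<close> differ, both
    products with \<open>d$3\<close> equal the same multiple of \<open>f\<close>, which forces
    \<open>d$3 = 0\<close>. The remaining equations then read \<open>f * d$1 = 0\<close> and
    \<open>f * d$2 = 0\<close>.\<close>
  ultimately have "d$3 = 0"
    by (metis mult_right_cancel)
  with e \<open>f \<noteq> 0\<close> have "d = 0"
    by (simp add: vec_eq_iff forall_3)
  then show ?thesis
    by (simp add: d_def)
qed

lemma object_velocity_field_surj:
  assumes "f \<noteq> 0"
  shows "\<exists>V. object_velocity_field f V = W"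
proof
  show "object_velocity_field f (\<lambda>p. vector [W p $ 1 / f, W p $ 2 / f, 0]) = W"
    using assms by (simp add: fun_eq_iff object_velocity_field_def vec_eq_iff forall_2)
qed

section \<open>Residual, gauge field and explanations\<close>

lemma camera_plus_object:
  "camera_part f T Z p + object_part Z W p = (1 / Z p) *\<^sub>R (M_mat f p *v T + W p)"
  by (simp add: camera_part_def object_part_def scaleR_add_right)

lemma gauge_object_field_reproduces:
  assumes "Z p \<noteq> 0"
  shows "(1 / Z p) *\<^sub>R (M_mat f p *v T + gauge_object_field f r T Z p) = r p"
  using assms by (simp add: gauge_object_field_def)

lemma object_part_gauge:
  assumes "Z p \<noteq> 0"
  shows "object_part Z (gauge_object_field f r T Z) p = r p - camera_part f T Z p"
  using assms by (simp add: object_part_def camera_part_def gauge_object_field_def scaleR_diff_right)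

lemma residual_image_motion:
  "residual f \<omega> (image_motion f \<omega> s) p
     = camera_part f (baseline s) (depth s) p + object_part (depth s) (scene_object_field f s) p"
  by (simp add: residual_def image_motion_def)

text \<open>Both scenes share the rotational term, so subtracting it loses no information. Using
  \<open>restrict\<close> turns agreement on \<Omega> into an equality of functions, which is what a
  prior takes as its argument.\<close>

lemma same_motion_iff_residual:
  "same_motion f \<omega> \<Omega> s s' \<longleftrightarrow>
     restrict (residual f \<omega> (image_motion f \<omega> s)) \<Omega>
       = restrict (residual f \<omega> (image_motion f \<omega> s')) \<Omega>"
  by (auto simp: same_motion_def residual_def restrict_def fun_eq_iff)

lemma prior_choice_cong:
  "same_motion f \<omega> \<Omega> s s' \<Longrightarrow> prior_choice f \<omega> \<Omega> \<pi> s = prior_choice f \<omega> \<Omega> \<pi> s'"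
  by (simp add: prior_choice_def same_motion_iff_residual)

text \<open>Multiplying by the positive depth solves the defining equation for \<open>W\<close>.
  Hence the object field on \<Omega> is forced by baseline and depth, and all freedom lies in the
  choice of these two.\<close>

lemma explanations_iff_gauge:
  "(T, Z, W) \<in> explanations f \<Omega> r \<longleftrightarrow>
     positive_on \<Omega> Z \<and> (\<forall>p\<in>\<Omega>. W p = gauge_object_field f r T Z p)"
proof -
  have "(1 / Z p) *\<^sub>R (M_mat f p *v T + W p) = r p \<longleftrightarrow> W p = gauge_object_field f r T Z p"
    if "0 < Z p" for p
  proof -
    have "(1 / Z p) *\<^sub>R (M_mat f p *v T + W p) = r p \<longleftrightarrow> M_mat f p *v T + W p = Z p *\<^sub>R r p"
      using that scaleR_cancel_left[of "1 / Z p" "M_mat f p *v T + W p" "Z p *\<^sub>R r p"] by simp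
    then show ?thesis
      by (auto simp: gauge_object_field_def algebra_simps)
  qed
  then show ?thesis
    by (auto simp: explanations_def positive_on_def)
qed

section \<open>Scenes realising a prescribed image motion\<close>

text \<open>The gauge field is the object field of some self-velocity, so each choice of baseline
  and positive depth belongs to an actual scene and not merely to a formal decomposition.\<close>

lemma scene_with_motion:
  assumes "f \<noteq> 0" "positive_on \<Omega> Z"
  shows "\<exists>s. valid_scene \<Omega> s \<and> baseline s = T \<and> depth s = Z \<and>
             scene_object_field f s = gauge_object_field f (residual f \<omega> u) T Z \<and>
             (\<forall>p\<in>\<Omega>. image_motion f \<omega> s p = u p)"
proof -
  obtain V where V: "object_velocity_field f V = gauge_object_field f (residual f \<omega> u) T Z"
    using object_velocity_field_surj[OF assms(1)] by blast
  define s where "s = \<lparr>baseline = T, depth = Z, self_velocity = V\<rparr>"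
  have s: "baseline s = T" "depth s = Z"
    "scene_object_field f s = gauge_object_field f (residual f \<omega> u) T Z"
    by (simp_all add: s_def scene_object_field_def V)
  have "image_motion f \<omega> s p = u p" if "p \<in> \<Omega>" for p
  proof -
    have "Z p \<noteq> 0"
      using that assms(2) by (auto simp: positive_on_def)
    then show ?thesis
      by (simp add: image_motion_def s object_part_gauge residual_def)
  qed
  with s assms(2) show ?thesis
    by (auto simp: valid_scene_def)
qed

lemma scene_with_same_motion:
  assumes "f \<noteq> 0" "positive_on \<Omega> Z"
  shows "\<exists>s'. valid_scene \<Omega> s' \<and> same_motion f \<omega> \<Omega> s s' \<and> baseline s' = T \<and> depth s' = Z"
proof -
  obtain s' where "valid_scene \<Omega> s'" "baseline s' = T" "depth s' = Z"
    "\<forall>p\<in>\<Omega>. image_motion f \<omega> s' p = image_motion f \<omega> s p"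
    using scene_with_motion[OF assms, of T \<omega> "image_motion f \<omega> s"] by blast
  then show ?thesis
    by (auto simp: same_motion_def)
qed

section \<open>Three-parameter affine families\<close>

text \<open>Subtracting the value at baseline 0 leaves \<open>(T, 0, - (M_mat f p *v T))\<close>,
  which is linear in \<open>T\<close>. Since \<open>T\<close> is itself a component, a single point
  already separates parameters.\<close>

lemma affine_parameters_gauge:
  assumes "\<Omega> \<noteq> {}"
  shows "affine_parameters \<Omega> (\<lambda>(T::real^3) p. (T, Z p, gauge_object_field f r T Z p))"
  unfolding affine_parameters_def
proof (intro conjI ballI)
  fix p
  show "linear (\<lambda>t. (t, Z p, gauge_object_field f r t Z p)
                    - (0, Z p, gauge_object_field f r 0 Z p))"
    by (rule linearI)
       (simp_all add: gauge_object_field_def matrix_vector_right_distrib matrix_vector_mult_scaleR)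
qed (use assms in auto)

text \<open>Here the baseline is visible only through the image motion it causes, so injectivity
  rests on two distinct image points.\<close>

lemma affine_parameters_parts:
  assumes "f \<noteq> 0" "positive_on \<Omega> Z" "p \<in> \<Omega>" "q \<in> \<Omega>" "p \<noteq> q"
  shows "affine_parameters \<Omega>
           (\<lambda>(T::real^3) p. (camera_part f T Z p, object_part Z (gauge_object_field f r T Z) p))"
  unfolding affine_parameters_def
proof (intro conjI ballI allI impI)
  fix p
  show "linear (\<lambda>t. (camera_part f t Z p, object_part Z (gauge_object_field f r t Z) p)
                    - (camera_part f 0 Z p, object_part Z (gauge_object_field f r 0 Z) p))"
    by (rule linearI)
       (simp_all add: camera_part_def object_part_def gauge_object_field_def algebra_simps
         matrix_vector_right_distrib matrix_vector_mult_scaleR)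
next
  fix S T :: "real^3"
  assume "S \<noteq> T"
  then obtain x where "x \<in> \<Omega>" and M: "M_mat f x *v S \<noteq> M_mat f x *v T"
    using M_mat_mult_eq_at_two_points assms by metis
  moreover have "0 < Z x"
    using \<open>x \<in> \<Omega>\<close> assms(2) by (simp add: positive_on_def)
  ultimately show "\<exists>x\<in>\<Omega>. (camera_part f S Z x, object_part Z (gauge_object_field f r S Z) x)
                      \<noteq> (camera_part f T Z x, object_part Z (gauge_object_field f r T Z) x)"
    by (auto simp: camera_part_def)
qed

section \<open>Controllers and priors\<close>

text \<open>The controller is constant on valid scenes with the same motion, so its baseline and
  depth factor through the restricted residual. That factor map is the prior, and
  \<open>explanations_iff_gauge\<close> forces the object field.\<close>

lemma conditioned_2D_resolved_by_prior:
  assumes C: "conditioned_2D f \<omega> \<Omega> C" and R: "resolves f \<omega> \<Omega> C"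
  shows "\<exists>\<pi>. resolved_by_prior f \<omega> \<Omega> C \<pi>"
proof
  let ?res = "\<lambda>s. residual f \<omega> (image_motion f \<omega> s)"
  \<comment> \<open>A representative valid scene for each restricted residual; its value is
    arbitrary when no valid scene produces \<open>r\<close>.\<close>
  define pick where "pick r = (SOME s. valid_scene \<Omega> s \<and> restrict (?res s) \<Omega> = r)" for r
  define \<pi> where "\<pi> r = (fst (C (pick r)), fst (snd (C (pick r))))" for r
  have choice: "prior_choice f \<omega> \<Omega> \<pi> s = (fst (C s), fst (snd (C s)))" if s: "valid_scene \<Omega> s" for s
  proof -
    let ?s' = "pick (restrict (?res s) \<Omega>)"
    have "valid_scene \<Omega> ?s' \<and> restrict (?res ?s') \<Omega> = restrict (?res s) \<Omega>"
      unfolding pick_def by (rule someI[of _ s]) (simp add: s)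
    then have "valid_scene \<Omega> ?s'" "same_motion f \<omega> \<Omega> ?s' s"
      by (simp_all only: same_motion_iff_residual)
    then have "C ?s' = C s"
      using C s unfolding conditioned_2D_def by blast
    then show ?thesis
      by (simp only: prior_choice_def \<pi>_def)
  qed
  show "resolved_by_prior f \<omega> \<Omega> C \<pi>"
    unfolding resolved_by_prior_def
  proof (intro allI impI)
    fix s T Z W
    assume s: "valid_scene \<Omega> s \<and> C s = (T, Z, W)"
    then have "(T, Z, W) \<in> explanations f \<Omega> (?res s)"
      using R by (metis resolves_def)
    then show "(T, Z) = prior_choice f \<omega> \<Omega> \<pi> s \<and>
      (\<forall>p\<in>\<Omega>. W p = gauge_object_field f (?res s) T Z p)"
      using s choice[of s] by (simp add: explanations_iff_gauge)
  qed
qed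

text \<open>Conversely, the pair chosen by a prior is completed by its gauge field; positivity of
  the chosen depth makes the result an explanation.\<close>

lemma prior_determines_controller:
  assumes "\<And>r. positive_on \<Omega> (snd (\<pi> r))"
  shows "\<exists>C. conditioned_2D f \<omega> \<Omega> C \<and> resolves f \<omega> \<Omega> C \<and> resolved_by_prior f \<omega> \<Omega> C \<pi>"
proof -
  let ?res = "\<lambda>s. residual f \<omega> (image_motion f \<omega> s)"
  \<comment> \<open>The residual is restricted inside the gauge as well, so that the controller depends on
    the image motion on \<open>\<Omega>\<close> only.\<close>
  define C where "C s = (let (T, Z) = prior_choice f \<omega> \<Omega> \<pi> s
    in (T, Z, gauge_object_field f (restrict (?res s) \<Omega>) T Z))" for s
  have "conditioned_2D f \<omega> \<Omega> C"
    by (simp add: conditioned_2D_def C_def prior_choice_def same_motion_iff_residual)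
  moreover have on: "gauge_object_field f (restrict (?res s) \<Omega>) T Z p = gauge_object_field f (?res s) T Z p"
    if "p \<in> \<Omega>" for s T Z p
    using that by (simp add: gauge_object_field_def)
  then have "resolved_by_prior f \<omega> \<Omega> C \<pi>"
    by (auto simp: resolved_by_prior_def C_def split: prod.splits)
  moreover have "resolves f \<omega> \<Omega> C"
    unfolding resolves_def
  proof (intro allI impI)
    fix s
    obtain T Z where TZ: "prior_choice f \<omega> \<Omega> \<pi> s = (T, Z)"
      by fastforce
    then have "positive_on \<Omega> Z"
      using assms[of "restrict (?res s) \<Omega>"] by (simp add: prior_choice_def)
    then show "C s \<in> explanations f \<Omega> (?res s)"
      by (simp add: C_def TZ explanations_iff_gauge on)
  qed
  ultimately show ?thesis
    by blast
qed

section \<open>Cross-talk from wrong priors\<close>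

text \<open>Realised and commanded parts have the same sum, the residual at \<open>p\<close>, so an
  error in the camera part is compensated by the opposite error in the object part.\<close>

lemma prior_wrong_imp_cross_talk:
  assumes R: "resolves f \<omega> \<Omega> C" and P: "resolved_by_prior f \<omega> \<Omega> C \<pi>"
    and s: "valid_scene \<Omega> s" and p: "p \<in> \<Omega>" and wrong: "prior_wrong_at f \<omega> \<Omega> \<pi> s p"
  shows "cross_talk_at f C s p"
proof -
  let ?res = "residual f \<omega> (image_motion f \<omega> s)"
  obtain T Z W where C: "C s = (T, Z, W)"
    by (cases "C s")
  have choice: "prior_choice f \<omega> \<Omega> \<pi> s = (T, Z)"
    using P s C by (simp add: resolved_by_prior_def)
  have "(T, Z, W) \<in> explanations f \<Omega> ?res"
    using R s C by (metis resolves_def)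
  then have "camera_part f T Z p + object_part Z W p = ?res p"
    using p by (auto simp: explanations_def camera_plus_object)
  then have "camera_part f T Z p + object_part Z W p
      = camera_part f (baseline s) (depth s) p + object_part (depth s) (scene_object_field f s) p"
    by (simp add: residual_image_motion)
  moreover have "camera_part f T Z p \<noteq> camera_part f (baseline s) (depth s) p"
    using wrong by (simp add: prior_wrong_at_def choice)
  ultimately show ?thesis
    unfolding cross_talk_at_def C
    \<comment> \<open>The leaked amount is the commanded camera part minus the realised one, nonzero
      because the prior is wrong at \<open>p\<close>.\<close>
    by (simp, intro exI[of _ "camera_part f (baseline s) (depth s) p - camera_part f T Z p"])
       (auto simp: algebra_simps)
qed

lemma wrong_baseline_unnoticed_at_one_point:
  assumes "f \<noteq> 0" and s: "valid_scene \<Omega> s"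
    and T: "fst (prior_choice f \<omega> \<Omega> \<pi> s) \<noteq> baseline s"
    and Z: "\<forall>p\<in>\<Omega>. snd (prior_choice f \<omega> \<Omega> \<pi> s) p = depth s p"
  shows "\<exists>p\<^sub>0. \<forall>p\<in>\<Omega> - {p\<^sub>0}. prior_wrong_at f \<omega> \<Omega> \<pi> s p"
proof -
  let ?T = "fst (prior_choice f \<omega> \<Omega> \<pi> s)"
  have wrong: "prior_wrong_at f \<omega> \<Omega> \<pi> s p"
    if "p \<in> \<Omega>" "M_mat f p *v ?T \<noteq> M_mat f p *v baseline s" for p
  proof -
    have "0 < depth s p"
      using s that(1) by (simp add: valid_scene_def positive_on_def)
    then show ?thesis
      using that Z by (auto simp: prior_wrong_at_def camera_part_def split: prod.splits)
  qed
  show ?thesis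
    using wrong M_mat_mult_eq_at_two_points[OF \<open>f \<noteq> 0\<close>] T by (metis DiffD1 DiffD2 singletonI)
qed

text \<open>The prior makes one choice for all scenes with the same motion, yet these scenes have
  different camera parts at \<open>p\<close>, and one choice cannot match them all.\<close>

lemma prior_wrong_for_indistinguishable_scene:
  assumes "f \<noteq> 0" and s: "valid_scene \<Omega> s" and p: "p \<in> \<Omega>"
  shows "\<exists>s'. valid_scene \<Omega> s' \<and> same_motion f \<omega> \<Omega> s s' \<and> prior_wrong_at f \<omega> \<Omega> \<pi> s' p"
proof -
  obtain T Z where TZ: "prior_choice f \<omega> \<Omega> \<pi> s = (T, Z)"
    by fastforce
  have pos: "positive_on \<Omega> (depth s)" "0 < depth s p"
    using s p by (simp_all add: valid_scene_def positive_on_def)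
  \<comment> \<open>The first unit vector is mapped by the camera matrix to \<open>(- f, 0)\<close>,
    which is nonzero. Of these two distinct camera parts at least one differs from the one chosen by
    the prior.\<close>
  have "camera_part f 0 (depth s) p \<noteq> camera_part f (axis 1 1) (depth s) p"
    using assms(1) pos(2)
    by (simp add: camera_part_def M_mat_mult vec_eq_iff forall_2 axis_def)
  then obtain T' where "camera_part f T Z p \<noteq> camera_part f T' (depth s) p"
    by metis
  moreover obtain s' where "valid_scene \<Omega> s'" "same_motion f \<omega> \<Omega> s s'"
    "baseline s' = T'" "depth s' = depth s"
    using scene_with_same_motion[OF assms(1) pos(1)] by metis
  ultimately show ?thesis
    using prior_choice_cong[of f \<omega> \<Omega> s s' \<pi>] TZ by (auto simp: prior_wrong_at_def)
qed

theorem theorem1: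
  fixes f :: real and \<omega> :: "real^3" and \<Omega> :: "point set" and u :: field
  assumes "0 < f"
  shows
    "(\<forall>T Z. positive_on \<Omega> Z \<longrightarrow>
        (\<forall>p\<in>\<Omega>. (1 / Z p) *\<^sub>R
            (M_mat f p *v T + gauge_object_field f (residual f \<omega> u) T Z p)
          = residual f \<omega> u p))
     \<and>
     (\<forall>T Z. positive_on \<Omega> Z \<longrightarrow>
        (\<exists>s. valid_scene \<Omega> s \<and> baseline s = T \<and> depth s = Z \<and>
             scene_object_field f s = gauge_object_field f (residual f \<omega> u) T Z \<and>
             (\<forall>p\<in>\<Omega>. image_motion f \<omega> s p = u p)))
     \<and>
     (\<forall>Z. positive_on \<Omega> Z \<longrightarrow>
        (\<forall>T. (T, Z, gauge_object_field f (residual f \<omega> u) T Z)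
               \<in> explanations f \<Omega> (residual f \<omega> u)) \<and>
        (\<Omega> \<noteq> {} \<longrightarrow>
           affine_parameters \<Omega>
             (\<lambda>(T::real^3) p. (T, Z p, gauge_object_field f (residual f \<omega> u) T Z p))) \<and>
        ((\<exists>p\<in>\<Omega>. \<exists>q\<in>\<Omega>. p \<noteq> q) \<longrightarrow>
           affine_parameters \<Omega>
             (\<lambda>(T::real^3) p. (camera_part f T Z p,
                object_part Z (gauge_object_field f (residual f \<omega> u) T Z) p))))
     \<and>
     (\<forall>C. conditioned_2D f \<omega> \<Omega> C \<longrightarrow>
        (\<forall>s T Z. valid_scene \<Omega> s \<and> positive_on \<Omega> Z \<longrightarrow>
           (\<exists>s'. valid_scene \<Omega> s' \<and> same_motion f \<omega> \<Omega> s s' \<and>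
                 baseline s' = T \<and> depth s' = Z \<and> C s' = C s)))
     \<and>
     (\<forall>C. conditioned_2D f \<omega> \<Omega> C \<and> resolves f \<omega> \<Omega> C \<longrightarrow>
        (\<exists>\<pi>. resolved_by_prior f \<omega> \<Omega> C \<pi>))
     \<and>
     (\<forall>\<pi>. (\<forall>r. positive_on \<Omega> (snd (\<pi> r))) \<longrightarrow>
        (\<exists>C. conditioned_2D f \<omega> \<Omega> C \<and> resolves f \<omega> \<Omega> C \<and>
             resolved_by_prior f \<omega> \<Omega> C \<pi>))
     \<and>
     (\<forall>C \<pi>. conditioned_2D f \<omega> \<Omega> C \<and> resolves f \<omega> \<Omega> C \<and>
             resolved_by_prior f \<omega> \<Omega> C \<pi> \<longrightarrow>
        (\<forall>s. valid_scene \<Omega> s \<longrightarrow>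
           (\<forall>p\<in>\<Omega>. prior_wrong_at f \<omega> \<Omega> \<pi> s p \<longrightarrow> cross_talk_at f C s p) \<and>
           (fst (prior_choice f \<omega> \<Omega> \<pi> s) \<noteq> baseline s \<and>
            (\<forall>p\<in>\<Omega>. snd (prior_choice f \<omega> \<Omega> \<pi> s) p = depth s p) \<longrightarrow>
              (\<exists>p\<^sub>0. \<forall>p\<in>\<Omega> - {p\<^sub>0}. cross_talk_at f C s p)) \<and>
           (\<forall>p\<in>\<Omega>. \<exists>s'. valid_scene \<Omega> s' \<and> same_motion f \<omega> \<Omega> s s' \<and>
                 prior_wrong_at f \<omega> \<Omega> \<pi> s' p \<and> cross_talk_at f C s' p)))"
proof (intro conjI)
  have f: "f \<noteq> 0"
    using assms by simp
  show "\<forall>T Z. positive_on \<Omega> Z \<longrightarrow>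
        (\<forall>p\<in>\<Omega>. (1 / Z p) *\<^sub>R
            (M_mat f p *v T + gauge_object_field f (residual f \<omega> u) T Z p)
          = residual f \<omega> u p)"
    by (metis gauge_object_field_reproduces less_irrefl positive_on_def)
  show "\<forall>T Z. positive_on \<Omega> Z \<longrightarrow>
        (\<exists>s. valid_scene \<Omega> s \<and> baseline s = T \<and> depth s = Z \<and>
             scene_object_field f s = gauge_object_field f (residual f \<omega> u) T Z \<and>
             (\<forall>p\<in>\<Omega>. image_motion f \<omega> s p = u p))"
    using scene_with_motion[OF f] by blast
  show "\<forall>Z. positive_on \<Omega> Z \<longrightarrow>
        (\<forall>T. (T, Z, gauge_object_field f (residual f \<omega> u) T Z)
               \<in> explanations f \<Omega> (residual f \<omega> u)) \<and>
        (\<Omega> \<noteq> {} \<longrightarrow>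
           affine_parameters \<Omega>
             (\<lambda>(T::real^3) p. (T, Z p, gauge_object_field f (residual f \<omega> u) T Z p))) \<and>
        ((\<exists>p\<in>\<Omega>. \<exists>q\<in>\<Omega>. p \<noteq> q) \<longrightarrow>
           affine_parameters \<Omega>
             (\<lambda>(T::real^3) p. (camera_part f T Z p,
                object_part Z (gauge_object_field f (residual f \<omega> u) T Z) p)))"
    using affine_parameters_gauge affine_parameters_parts[OF f]
    by (auto simp: explanations_iff_gauge)
  show "\<forall>C. conditioned_2D f \<omega> \<Omega> C \<longrightarrow>
        (\<forall>s T Z. valid_scene \<Omega> s \<and> positive_on \<Omega> Z \<longrightarrow>
           (\<exists>s'. valid_scene \<Omega> s' \<and> same_motion f \<omega> \<Omega> s s' \<and>
                 baseline s' = T \<and> depth s' = Z \<and> C s' = C s))"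
    using scene_with_same_motion[OF f] unfolding conditioned_2D_def by metis
  show "\<forall>C. conditioned_2D f \<omega> \<Omega> C \<and> resolves f \<omega> \<Omega> C \<longrightarrow>
        (\<exists>\<pi>. resolved_by_prior f \<omega> \<Omega> C \<pi>)"
    using conditioned_2D_resolved_by_prior by blast
  show "\<forall>\<pi>. (\<forall>r. positive_on \<Omega> (snd (\<pi> r))) \<longrightarrow>
        (\<exists>C. conditioned_2D f \<omega> \<Omega> C \<and> resolves f \<omega> \<Omega> C \<and>
             resolved_by_prior f \<omega> \<Omega> C \<pi>)"
    using prior_determines_controller by blast
  show "\<forall>C \<pi>. conditioned_2D f \<omega> \<Omega> C \<and> resolves f \<omega> \<Omega> C \<and>
             resolved_by_prior f \<omega> \<Omega> C \<pi> \<longrightarrow>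
        (\<forall>s. valid_scene \<Omega> s \<longrightarrow>
           (\<forall>p\<in>\<Omega>. prior_wrong_at f \<omega> \<Omega> \<pi> s p \<longrightarrow> cross_talk_at f C s p) \<and>
           (fst (prior_choice f \<omega> \<Omega> \<pi> s) \<noteq> baseline s \<and>
            (\<forall>p\<in>\<Omega>. snd (prior_choice f \<omega> \<Omega> \<pi> s) p = depth s p) \<longrightarrow>
              (\<exists>p\<^sub>0. \<forall>p\<in>\<Omega> - {p\<^sub>0}. cross_talk_at f C s p)) \<and>
           (\<forall>p\<in>\<Omega>. \<exists>s'. valid_scene \<Omega> s' \<and> same_motion f \<omega> \<Omega> s s' \<and>
                 prior_wrong_at f \<omega> \<Omega> \<pi> s' p \<and> cross_talk_at f C s' p))"
  proof (intro allI impI, elim conjE, intro conjI ballI impI)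
    fix C \<pi> s
    assume R: "resolves f \<omega> \<Omega> C" and P: "resolved_by_prior f \<omega> \<Omega> C \<pi>" and s: "valid_scene \<Omega> s"
    \<comment> \<open>The scene stays free here, since the last claim applies the fact to
      \<open>s'\<close> instead of \<open>s\<close>.\<close>
    note talk = prior_wrong_imp_cross_talk[OF R P]
    show "cross_talk_at f C s p" if "p \<in> \<Omega>" "prior_wrong_at f \<omega> \<Omega> \<pi> s p" for p
      using talk[OF s that] .
    show "\<exists>p\<^sub>0. \<forall>p\<in>\<Omega> - {p\<^sub>0}. cross_talk_at f C s p"
      if "fst (prior_choice f \<omega> \<Omega> \<pi> s) \<noteq> baseline s \<and>
          (\<forall>p\<in>\<Omega>. snd (prior_choice f \<omega> \<Omega> \<pi> s) p = depth s p)"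
      using wrong_baseline_unnoticed_at_one_point[OF f s] that talk[OF s] by (metis DiffD1)
    show "\<exists>s'. valid_scene \<Omega> s' \<and> same_motion f \<omega> \<Omega> s s' \<and>
            prior_wrong_at f \<omega> \<Omega> \<pi> s' p \<and> cross_talk_at f C s' p" if "p \<in> \<Omega>" for p
      using prior_wrong_for_indistinguishable_scene[OF f s that] talk that by metis
  qed
qed

end
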